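(* Suppose $\frac{2\delta}{\mu}<\alpha$ and $M_\alpha<M\le M_\beta$. Then the function $$V(x)=\begin{cases}K_1(\alpha,\beta)\left(e^{r_+(\alpha)x}-e^{r_-(\alpha)x}\right), & 0\le x<x_\alpha,\\[1mm] \dfrac{\mu a(x)-2\delta}{2\gamma}\left(\dfrac{a(x)-c}{\tilde c-c}\right)^{-\Gamma}, & x_\alpha\le x<x_1,\\[1mm] \dfrac{M}{\gamma}-\dfrac{\sigma^2\tilde c}{\mu}\exp\left(-\dfrac{\mu}{\sigma^2\tilde c}(x-x_1)\right), & x\ge x_1,\end{cases}$$ (with all quantities as defined in the context) is a concave, twice differentiable solution on $[0,\infty)$ of the HJB equation $$0=\max_{\alpha\le a\le\beta}\left(\tfrac12\sigma^2a^2V''(x)+(a\mu-\delta)V'(x)-\gamma V(x)+M(1-V'(x))^+\right),\qquad V(0)=0,$$ and it satisfies $0\le V(x)\le\frac{M}{\gamma}$ for all $x>0$.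
   Context: Parameters: real constants $\mu>0$, $\sigma>0$, $\gamma>0$, $\delta\ge0$, $M>0$, $0<\alpha<\beta<\infty$; $y^+=\max(y,0)$. $r_\pm(\alpha)=\dfrac{-(\alpha\mu-\delta)\pm\sqrt{(\alpha\mu-\delta)^2+2\gamma\sigma^2\alpha^2}}{\sigma^2\alpha^2}$. $c=\dfrac{2\delta\mu}{\mu^2+2\gamma\sigma^2}$, $\tilde c=\dfrac{2\mu(\delta+M)}{\mu^2+2\gamma\sigma^2}$, $\Gamma=\dfrac{\mu^2}{\mu^2+2\gamma\sigma^2}$, $M_z=(z-c)\dfrac{\mu^2+2\gamma\sigma^2}{2\mu}$ for $z>0$, and $G(u)=u+c\log(u-c)$ for $u>c$, with $G^{-1}$ its inverse. $x_\alpha=\dfrac{1}{r_+(\alpha)-r_-(\alpha)}\log\left(\dfrac{r_-(\alpha)(\mu+\alpha\sigma^2r_-(\alpha))}{r_+(\alpha)(\mu+\alpha\sigma^2r_+(\alpha))}\right)$. $a(x)=G^{-1}\left(\dfrac{\mu^2+2\gamma\sigma^2}{\mu\sigma^2}(x-x_\alpha)+G(\alpha)\right)$ for $x\ge x_\alpha$. $x_1$ is the root of $a(x_1)=\tilde c$, i.e. $x_1=x_\alpha+\dfrac{\mu\sigma^2}{\mu^2+2\gamma\sigma^2}[G(\tilde c)-G(\alpha)]$. $K_1(\alpha,\beta)=\dfrac{\left((\tilde c-c)/(\alpha-c)\right)^{\Gamma}}{r_+(\alpha)e^{r_+(\alpha)x_\alpha}-r_-(\alpha)e^{r_-(\alpha)x_\alpha}}$.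 *)

theory Defs
  imports "HOL-Analysis.Analysis"
begin

definition r_plus :: "real \<Rightarrow> real \<Rightarrow> real \<Rightarrow> real \<Rightarrow> real \<Rightarrow> real" where
  "r_plus \<mu> \<sigma> \<gamma> \<delta> \<alpha> =
     (- (\<alpha> * \<mu> - \<delta>) + sqrt ((\<alpha> * \<mu> - \<delta>)\<^sup>2 + 2 * \<gamma> * \<sigma>\<^sup>2 * \<alpha>\<^sup>2)) / (\<sigma>\<^sup>2 * \<alpha>\<^sup>2)"

definition r_minus :: "real \<Rightarrow> real \<Rightarrow> real \<Rightarrow> real \<Rightarrow> real \<Rightarrow> real" where
  "r_minus \<mu> \<sigma> \<gamma> \<delta> \<alpha> =
     (- (\<alpha> * \<mu> - \<delta>) - sqrt ((\<alpha> * \<mu> - \<delta>)\<^sup>2 + 2 * \<gamma> * \<sigma>\<^sup>2 * \<alpha>\<^sup>2)) / (\<sigma>\<^sup>2 * \<alpha>\<^sup>2)"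

definition c_const :: "real \<Rightarrow> real \<Rightarrow> real \<Rightarrow> real \<Rightarrow> real" where
  "c_const \<mu> \<sigma> \<gamma> \<delta> = 2 * \<delta> * \<mu> / (\<mu>\<^sup>2 + 2 * \<gamma> * \<sigma>\<^sup>2)"

definition c_tilde :: "real \<Rightarrow> real \<Rightarrow> real \<Rightarrow> real \<Rightarrow> real \<Rightarrow> real" where
  "c_tilde \<mu> \<sigma> \<gamma> \<delta> M = 2 * \<mu> * (\<delta> + M) / (\<mu>\<^sup>2 + 2 * \<gamma> * \<sigma>\<^sup>2)"

definition Gam :: "real \<Rightarrow> real \<Rightarrow> real \<Rightarrow> real" where
  "Gam \<mu> \<sigma> \<gamma> = \<mu>\<^sup>2 / (\<mu>\<^sup>2 + 2 * \<gamma> * \<sigma>\<^sup>2)"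

definition M_level :: "real \<Rightarrow> real \<Rightarrow> real \<Rightarrow> real \<Rightarrow> real \<Rightarrow> real" where
  "M_level \<mu> \<sigma> \<gamma> \<delta> z = (z - c_const \<mu> \<sigma> \<gamma> \<delta>) * ((\<mu>\<^sup>2 + 2 * \<gamma> * \<sigma>\<^sup>2) / (2 * \<mu>))"

text \<open>\<open>G_fun\<close> is meaningful only for \<open>u > c\<close>; its inverse is accordingly taken on
  \<open>{c<..}\<close>, where \<open>G_fun\<close> is injective.\<close>

definition G_fun :: "real \<Rightarrow> real \<Rightarrow> real \<Rightarrow> real \<Rightarrow> real \<Rightarrow> real" where
  "G_fun \<mu> \<sigma> \<gamma> \<delta> u = u + c_const \<mu> \<sigma> \<gamma> \<delta> * ln (u - c_const \<mu> \<sigma> \<gamma> \<delta>)"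

definition G_inv :: "real \<Rightarrow> real \<Rightarrow> real \<Rightarrow> real \<Rightarrow> real \<Rightarrow> real" where
  "G_inv \<mu> \<sigma> \<gamma> \<delta> = inv_into {c_const \<mu> \<sigma> \<gamma> \<delta><..} (G_fun \<mu> \<sigma> \<gamma> \<delta>)"

definition x_alpha :: "real \<Rightarrow> real \<Rightarrow> real \<Rightarrow> real \<Rightarrow> real \<Rightarrow> real" where
  "x_alpha \<mu> \<sigma> \<gamma> \<delta> \<alpha> =
     (let rp = r_plus \<mu> \<sigma> \<gamma> \<delta> \<alpha>; rm = r_minus \<mu> \<sigma> \<gamma> \<delta> \<alpha>
      in 1 / (rp - rm) *
         ln ((rm * (\<mu> + \<alpha> * \<sigma>\<^sup>2 * rm)) / (rp * (\<mu> + \<alpha> * \<sigma>\<^sup>2 * rp))))"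

text \<open>\<open>a_fun\<close> is used only for \<open>x \<ge> x_alpha\<close>.\<close>

definition a_fun :: "real \<Rightarrow> real \<Rightarrow> real \<Rightarrow> real \<Rightarrow> real \<Rightarrow> real \<Rightarrow> real" where
  "a_fun \<mu> \<sigma> \<gamma> \<delta> \<alpha> x =
     G_inv \<mu> \<sigma> \<gamma> \<delta>
       ((\<mu>\<^sup>2 + 2 * \<gamma> * \<sigma>\<^sup>2) / (\<mu> * \<sigma>\<^sup>2) * (x - x_alpha \<mu> \<sigma> \<gamma> \<delta> \<alpha>) + G_fun \<mu> \<sigma> \<gamma> \<delta> \<alpha>)"

text \<open>The root \<open>x\<^sub>1\<close> of \<open>a_fun x\<^sub>1 = c_tilde\<close> in closed form; see \<open>a_fun_x_one\<close> below.\<close>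

definition x_one :: "real \<Rightarrow> real \<Rightarrow> real \<Rightarrow> real \<Rightarrow> real \<Rightarrow> real \<Rightarrow> real" where
  "x_one \<mu> \<sigma> \<gamma> \<delta> M \<alpha> =
     x_alpha \<mu> \<sigma> \<gamma> \<delta> \<alpha> + \<mu> * \<sigma>\<^sup>2 / (\<mu>\<^sup>2 + 2 * \<gamma> * \<sigma>\<^sup>2) *
       (G_fun \<mu> \<sigma> \<gamma> \<delta> (c_tilde \<mu> \<sigma> \<gamma> \<delta> M) - G_fun \<mu> \<sigma> \<gamma> \<delta> \<alpha>)"

lemma G_fun_inj_on:
  assumes "\<mu> > 0" "\<gamma> > 0" "\<delta> \<ge> 0"
  shows "inj_on (G_fun \<mu> \<sigma> \<gamma> \<delta>) {c_const \<mu> \<sigma> \<gamma> \<delta><..}"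
proof (rule strict_mono_on_imp_inj_on, rule strict_mono_onI)
  fix u v assume uv: "u \<in> {c_const \<mu> \<sigma> \<gamma> \<delta><..}" "v \<in> {c_const \<mu> \<sigma> \<gamma> \<delta><..}" "u < v"
  have "c_const \<mu> \<sigma> \<gamma> \<delta> \<ge> 0"
    using assms by (simp add: c_const_def)
  moreover have "ln (u - c_const \<mu> \<sigma> \<gamma> \<delta>) \<le> ln (v - c_const \<mu> \<sigma> \<gamma> \<delta>)"
    using uv by simp
  ultimately show "G_fun \<mu> \<sigma> \<gamma> \<delta> u < G_fun \<mu> \<sigma> \<gamma> \<delta> v"
    unfolding G_fun_def using uv by (intro add_less_le_mono mult_left_mono) auto
qed

lemma a_fun_x_one:
  assumes "\<mu> > 0" "\<sigma> > 0" "\<gamma> > 0" "\<delta> \<ge> 0" "M > 0"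
  shows "a_fun \<mu> \<sigma> \<gamma> \<delta> \<alpha> (x_one \<mu> \<sigma> \<gamma> \<delta> M \<alpha>) = c_tilde \<mu> \<sigma> \<gamma> \<delta> M"
proof -
  have D: "\<mu>\<^sup>2 + 2 * \<gamma> * \<sigma>\<^sup>2 > 0"
    using assms by (simp add: add_pos_pos)
  have "c_tilde \<mu> \<sigma> \<gamma> \<delta> M > c_const \<mu> \<sigma> \<gamma> \<delta>"
    using assms D by (simp add: c_tilde_def c_const_def divide_strict_right_mono)
  moreover have "(\<mu>\<^sup>2 + 2 * \<gamma> * \<sigma>\<^sup>2) / (\<mu> * \<sigma>\<^sup>2) * (x_one \<mu> \<sigma> \<gamma> \<delta> M \<alpha> - x_alpha \<mu> \<sigma> \<gamma> \<delta> \<alpha>)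
      = G_fun \<mu> \<sigma> \<gamma> \<delta> (c_tilde \<mu> \<sigma> \<gamma> \<delta> M) - G_fun \<mu> \<sigma> \<gamma> \<delta> \<alpha>"
    using assms D by (simp add: x_one_def)
  ultimately show ?thesis
    using assms by (simp add: a_fun_def G_inv_def inv_into_f_f[OF G_fun_inj_on])
qed

text \<open>The constant usually written \<open>K\<^sub>1(\<alpha>, \<beta>)\<close>; it depends on \<open>M\<close> through \<open>c_tilde\<close> but
  not on \<open>\<beta>\<close>.\<close>

definition K_one :: "real \<Rightarrow> real \<Rightarrow> real \<Rightarrow> real \<Rightarrow> real \<Rightarrow> real \<Rightarrow> real" where
  "K_one \<mu> \<sigma> \<gamma> \<delta> M \<alpha> =
     (let rp = r_plus \<mu> \<sigma> \<gamma> \<delta> \<alpha>; rm = r_minus \<mu> \<sigma> \<gamma> \<delta> \<alpha>;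
          c = c_const \<mu> \<sigma> \<gamma> \<delta>; xa = x_alpha \<mu> \<sigma> \<gamma> \<delta> \<alpha>
      in ((c_tilde \<mu> \<sigma> \<gamma> \<delta> M - c) / (\<alpha> - c)) powr Gam \<mu> \<sigma> \<gamma>
         / (rp * exp (rp * xa) - rm * exp (rm * xa)))"

text \<open>The value function is only considered on \<open>{0..}\<close>; its values at negative
  arguments are irrelevant.\<close>

definition V_fun :: "real \<Rightarrow> real \<Rightarrow> real \<Rightarrow> real \<Rightarrow> real \<Rightarrow> real \<Rightarrow> real \<Rightarrow> real" where
  "V_fun \<mu> \<sigma> \<gamma> \<delta> M \<alpha> x =
     (let rp = r_plus \<mu> \<sigma> \<gamma> \<delta> \<alpha>; rm = r_minus \<mu> \<sigma> \<gamma> \<delta> \<alpha>;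
          c = c_const \<mu> \<sigma> \<gamma> \<delta>; ct = c_tilde \<mu> \<sigma> \<gamma> \<delta> M;
          a = a_fun \<mu> \<sigma> \<gamma> \<delta> \<alpha> x; x1 = x_one \<mu> \<sigma> \<gamma> \<delta> M \<alpha>
      in if x < x_alpha \<mu> \<sigma> \<gamma> \<delta> \<alpha> then
           K_one \<mu> \<sigma> \<gamma> \<delta> M \<alpha> * (exp (rp * x) - exp (rm * x))
         else if x < x1 then
           (\<mu> * a - 2 * \<delta>) / (2 * \<gamma>) * ((a - c) / (ct - c)) powr (- Gam \<mu> \<sigma> \<gamma>)
         else
           M / \<gamma> - \<sigma>\<^sup>2 * ct / \<mu> * exp (- (\<mu> / (\<sigma>\<^sup>2 * ct)) * (x - x1)))"

text \<open>\<open>v\<close>, \<open>v1\<close>, \<open>v2\<close> stand for \<open>V x\<close>, \<open>V' x\<close>, \<open>V'' x\<close>.\<close>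

definition hjb_expr ::
  "real \<Rightarrow> real \<Rightarrow> real \<Rightarrow> real \<Rightarrow> real \<Rightarrow> real \<Rightarrow> real \<Rightarrow> real \<Rightarrow> real \<Rightarrow> real" where
  "hjb_expr \<mu> \<sigma> \<gamma> \<delta> M v v1 v2 a =
     1 / 2 * \<sigma>\<^sup>2 * a\<^sup>2 * v2 + (a * \<mu> - \<delta>) * v1 - \<gamma> * v + M * max (1 - v1) 0"

text \<open>\<open>m\<close> is the maximum, attained, of \<open>f\<close> over \<open>A\<close>; \<^const>\<open>Max\<close> is only meaningful for
  finite sets.\<close>

definition is_max_on :: "('a \<Rightarrow> real) \<Rightarrow> 'a set \<Rightarrow> real \<Rightarrow> bool" where
  "is_max_on f A m \<longleftrightarrow> m \<in> f ` A \<and> (\<forall>y \<in> f ` A. y \<le> m)"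

text \<open>\<open>V\<close> is twice differentiable on \<open>{0..}\<close> (one-sidedly at \<open>0\<close>) and solves the HJB
  equation there. Derivatives within \<open>{0..}\<close> are unique, so \<open>V'\<close> and \<open>V''\<close>
  are determined by \<open>V\<close> on \<open>{0..}\<close>.\<close>

definition hjb_solution ::
  "real \<Rightarrow> real \<Rightarrow> real \<Rightarrow> real \<Rightarrow> real \<Rightarrow> real \<Rightarrow> real \<Rightarrow> (real \<Rightarrow> real) \<Rightarrow> bool" where
  "hjb_solution \<mu> \<sigma> \<gamma> \<delta> M \<alpha> \<beta> V \<longleftrightarrow>
     (\<exists>V' V''.
        (\<forall>x\<in>{0..}. (V has_real_derivative V' x) (at x within {0..})) \<and>
        (\<forall>x\<in>{0..}. (V' has_real_derivative V'' x) (at x within {0..})) \<and>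
        (\<forall>x\<in>{0..}. is_max_on (hjb_expr \<mu> \<sigma> \<gamma> \<delta> M (V x) (V' x) (V'' x)) {\<alpha>..\<beta>} 0)) \<and>
     V 0 = 0"

end

theory Submission imports Defs begin

text \<open>
  The function is assembled from three explicit pieces, and the proof reads off everything from
  their first two derivatives. While \<open>V'' < 0\<close>, the HJB expression is a concave parabola in the
  control \<open>a\<close>, with vertex at the zero of \<open>\<sigma>\<^sup>2 a V'' + \<mu> V'\<close>. Hence a control \<open>a\<^sub>0\<close> is optimal
  as soon as this first-order expression vanishes at \<open>a\<^sub>0\<close>, or is nonpositive at the left end
  \<open>a\<^sub>0 = \<alpha>\<close> (lemma \<open>is_max_on_hjb_expr\<close>). It then remains to check that the linear equation with
  control \<open>a\<^sub>0\<close> holds, with the term \<open>M (1 - V')\<close> absent where \<open>V' \<ge> 1\<close> and present where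
  \<open>V' \<le> 1\<close>.

  On \<open>x < x\<^sub>\<alpha>\<close> the optimal control is \<open>\<alpha>\<close>: the two exponentials solve the linear equation with
  constant coefficients, and the first-order expression is increasing in \<open>x\<close> and vanishes exactly
  at \<open>x\<^sub>\<alpha>\<close>. On \<open>x\<^sub>\<alpha> \<le> x < x\<^sub>1\<close> it is \<open>a(x)\<close>, which rises from \<open>\<alpha>\<close> to
  \<open>c_tilde\<close>; differentiating \<open>G (a(x))\<close> gives \<open>a' = (\<mu>\<^sup>2 + 2\<gamma>\<sigma>\<^sup>2)(a - c) / (\<mu>\<sigma>\<^sup>2 a)\<close>, from which
  \<open>V' = ((a - c) / (c_tilde - c)) powr (-\<Gamma>)\<close> and \<open>V'' = -\<mu> V' / (\<sigma>\<^sup>2 a)\<close>. On \<open>x \<ge> x\<^sub>1\<close> it is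
  the constant \<open>c_tilde\<close>, and there \<open>V' \<le> 1\<close>. The two bounds on
  \<open>M\<close> say precisely that \<open>\<alpha> < c_tilde \<le> \<beta>\<close>, so all these controls are admissible, while
  \<open>2\<delta> / \<mu> < \<alpha>\<close> gives \<open>c < \<alpha>\<close> and \<open>x\<^sub>\<alpha> > 0\<close>.

  At \<open>x\<^sub>\<alpha>\<close> and \<open>x\<^sub>1\<close> only the first derivatives need to be compared directly. Both adjacent pieces
  satisfy the first-order condition and the linear equation with the same control there, and
  these two relations determine \<open>V''\<close> and then \<open>V\<close> from \<open>V'\<close>. The glued function
  therefore has two derivatives (lemma \<open>DERIV_glue\<close>), with \<open>V'' < 0 < V'\<close>. Concavity follows, and
  monotonicity puts \<open>V\<close> between \<open>V 0 = 0\<close> and its bound \<open>M / \<gamma>\<close> on the last piece.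
\<close>

section \<open>Piecewise derivatives and the optimal control\<close>

text \<open>Each piece only has to be differentiable on its own closed side of \<open>p\<close>. This matters for
  the middle piece of \<open>V\<close>, whose inverse function \<open>G_inv\<close> is controlled only for arguments in the
  range of \<open>G_fun\<close>.\<close>

lemma DERIV_glue:
  fixes g h :: "real \<Rightarrow> real"
  assumes g: "x \<le> p \<Longrightarrow> (g has_real_derivative g' x) (at x)"
    and h: "p \<le> x \<Longrightarrow> (h has_real_derivative h' x) (at x)"
    and match: "g p = h p" "g' p = h' p"
  shows "((\<lambda>t. if t < p then g t else h t) has_real_derivative
           (if x < p then g' x else h' x)) (at x)" (is "(?f has_real_derivative _) _")
proof (cases x p rule: linorder_cases)
  case less
  have "(?f has_real_derivative g' x) (at x)"
    by (rule has_field_derivative_transform_within_open[OF g, of "{..<p}"]) (use less in auto)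
  then show ?thesis using less by simp
next
  case greater
  have "(?f has_real_derivative h' x) (at x)"
    by (rule has_field_derivative_transform_within_open[OF h, of "{p<..}"]) (use greater in auto)
  then show ?thesis using greater by simp
next
  case equal
  have "(?f has_real_derivative g' p) (at p within {..p})"
    by (rule has_field_derivative_transform_within[where f = g and d = 1])
       (use equal g match in \<open>auto intro: has_field_derivative_at_within\<close>)
  moreover have "(?f has_real_derivative g' p) (at p within {p..})"
    by (rule has_field_derivative_transform_within[where f = h and d = 1])
       (use equal h match in \<open>auto intro: has_field_derivative_at_within\<close>)
  ultimately have "(?f has_real_derivative g' p) (at p within {..p} \<union> {p..})"
    unfolding has_field_derivative_iff by (rule Lim_Un)
  moreover have "{..p} \<union> {p..} = UNIV" by auto
  ultimately show ?thesis using equal match by simp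
qed

text \<open>The exact second-order expansion of the HJB expression about \<open>a\<^sub>0\<close> has first-order
  coefficient \<open>\<sigma>\<^sup>2 a\<^sub>0 v2 + \<mu> v1\<close> and a nonpositive quadratic term. Stating the first-order condition
  as a variational inequality covers interior maximizers and the end point \<open>\<alpha>\<close> at once.\<close>

lemma is_max_on_hjb_expr:
  assumes a0: "a\<^sub>0 \<in> {\<alpha>..\<beta>}" and zero: "hjb_expr \<mu> \<sigma> \<gamma> \<delta> M v v1 v2 a\<^sub>0 = 0"
    and v2: "v2 \<le> 0"
    and first_order: "\<And>a. a \<in> {\<alpha>..\<beta>} \<Longrightarrow> (a - a\<^sub>0) * (\<sigma>\<^sup>2 * a\<^sub>0 * v2 + \<mu> * v1) \<le> 0"
  shows "is_max_on (hjb_expr \<mu> \<sigma> \<gamma> \<delta> M v v1 v2) {\<alpha>..\<beta>} 0"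
proof -
  have "hjb_expr \<mu> \<sigma> \<gamma> \<delta> M v v1 v2 a \<le> 0" if a: "a \<in> {\<alpha>..\<beta>}" for a
  proof -
    have "hjb_expr \<mu> \<sigma> \<gamma> \<delta> M v v1 v2 a - hjb_expr \<mu> \<sigma> \<gamma> \<delta> M v v1 v2 a\<^sub>0
        = (a - a\<^sub>0) * (\<sigma>\<^sup>2 * a\<^sub>0 * v2 + \<mu> * v1) + 1 / 2 * (\<sigma>\<^sup>2 * (a - a\<^sub>0)\<^sup>2) * v2"
      unfolding hjb_expr_def by (simp add: power2_eq_square algebra_simps)
    moreover have "1 / 2 * (\<sigma>\<^sup>2 * (a - a\<^sub>0)\<^sup>2) * v2 \<le> 0"
      using v2 by (intro mult_nonneg_nonpos) auto
    ultimately show ?thesis using first_order[OF a] zero by linarith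
  qed
  moreover have "0 \<in> hjb_expr \<mu> \<sigma> \<gamma> \<delta> M v v1 v2 ` {\<alpha>..\<beta>}"
    using a0 zero by (metis imageI)
  ultimately show ?thesis by (auto simp: is_max_on_def)
qed

locale hjb_parameters =
  fixes \<mu> \<sigma> \<gamma> \<delta> M \<alpha> \<beta> :: real
  assumes mu_pos: "\<mu> > 0" and sigma_pos: "\<sigma> > 0" and gamma_pos: "\<gamma> > 0"
    and delta_nonneg: "\<delta> \<ge> 0" and M_pos: "M > 0"
    and alpha_pos: "0 < \<alpha>" and alpha_less_beta: "\<alpha> < \<beta>"
    and alpha_large: "2 * \<delta> / \<mu> < \<alpha>"
    and M_lower: "M_level \<mu> \<sigma> \<gamma> \<delta> \<alpha> < M" and M_upper: "M \<le> M_level \<mu> \<sigma> \<gamma> \<delta> \<beta>"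
begin

abbreviation D where "D \<equiv> \<mu>\<^sup>2 + 2 * \<gamma> * \<sigma>\<^sup>2"
abbreviation c where "c \<equiv> c_const \<mu> \<sigma> \<gamma> \<delta>"
abbreviation ct where "ct \<equiv> c_tilde \<mu> \<sigma> \<gamma> \<delta> M"
abbreviation \<Gamma> where "\<Gamma> \<equiv> Gam \<mu> \<sigma> \<gamma>"
abbreviation rp where "rp \<equiv> r_plus \<mu> \<sigma> \<gamma> \<delta> \<alpha>"
abbreviation rm where "rm \<equiv> r_minus \<mu> \<sigma> \<gamma> \<delta> \<alpha>"
abbreviation xa where "xa \<equiv> x_alpha \<mu> \<sigma> \<gamma> \<delta> \<alpha>"
abbreviation x1 where "x1 \<equiv> x_one \<mu> \<sigma> \<gamma> \<delta> M \<alpha>"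
abbreviation G where "G \<equiv> G_fun \<mu> \<sigma> \<gamma> \<delta>"
abbreviation a where "a \<equiv> a_fun \<mu> \<sigma> \<gamma> \<delta> \<alpha>"
abbreviation K where "K \<equiv> K_one \<mu> \<sigma> \<gamma> \<delta> M \<alpha>"

section \<open>Order of the thresholds\<close>

lemma D_pos: "D > 0"
  using mu_pos sigma_pos gamma_pos by (simp add: add_pos_pos)

lemma alpha_mu: "2 * \<delta> < \<alpha> * \<mu>"
  using alpha_large mu_pos by (simp add: field_simps)

lemma D_c: "D * c = 2 * \<delta> * \<mu>" and D_ct: "D * ct = 2 * \<mu> * (\<delta> + M)"
  and D_Gam: "D * \<Gamma> = \<mu>\<^sup>2"
  using D_pos by (simp_all add: c_const_def c_tilde_def Gam_def)

lemma c_nonneg: "c \<ge> 0"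
  using D_pos mu_pos delta_nonneg by (simp add: c_const_def)

lemma c_less_alpha: "c < \<alpha>"
proof -
  have "D * c = \<mu> * (2 * \<delta>)" by (simp add: D_c)
  also have "\<dots> < \<mu> * (\<alpha> * \<mu>)" using alpha_mu mu_pos by simp
  also have "\<dots> \<le> D * \<alpha>"
    using alpha_pos gamma_pos by (simp add: algebra_simps power2_eq_square)
  finally show ?thesis using D_pos by (simp add: mult_less_cancel_left_pos)
qed

text \<open>The level \<open>M\<close> is \<open>M_level\<close> at \<open>c_tilde\<close>, and \<open>M_level\<close> is strictly increasing; so the
  bounds on \<open>M\<close> become bounds on \<open>c_tilde\<close>.\<close>

lemma ct_minus_c: "(ct - c) * (D / (2 * \<mu>)) = M"
proof -
  have "(ct - c) * D = M * (2 * \<mu>)"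
    using D_c D_ct by (simp add: algebra_simps)
  then show ?thesis using mu_pos by simp
qed

lemma alpha_less_ct: "\<alpha> < ct"
proof -
  have "(\<alpha> - c) * (D / (2 * \<mu>)) < (ct - c) * (D / (2 * \<mu>))"
    using M_lower unfolding ct_minus_c by (simp add: M_level_def)
  moreover have "D / (2 * \<mu>) > 0" using D_pos mu_pos by simp
  ultimately have "\<alpha> - c < ct - c" by (simp only: mult_less_cancel_right_pos)
  then show ?thesis by simp
qed

lemma ct_le_beta: "ct \<le> \<beta>"
proof -
  have "(ct - c) * (D / (2 * \<mu>)) \<le> (\<beta> - c) * (D / (2 * \<mu>))"
    using M_upper unfolding ct_minus_c by (simp add: M_level_def)
  moreover have "D / (2 * \<mu>) > 0" using D_pos mu_pos by simp
  ultimately have "ct - c \<le> \<beta> - c" by (simp only: mult_le_cancel_right_pos)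
  then show ?thesis by simp
qed

lemma ct_pos: "ct > 0" and c_less_ct: "c < ct"
  using alpha_pos alpha_less_ct c_less_alpha by linarith+

section \<open>The zone of minimal control\<close>

lemma characteristic_equation:
  assumes "r = rp \<or> r = rm"
  shows "1 / 2 * \<sigma>\<^sup>2 * \<alpha>\<^sup>2 * r\<^sup>2 + (\<alpha> * \<mu> - \<delta>) * r - \<gamma> = 0"
proof -
  define p where "p = \<alpha> * \<mu> - \<delta>"
  define q where "q = \<sigma>\<^sup>2 * \<alpha>\<^sup>2"
  have q: "q > 0" using sigma_pos alpha_pos by (simp add: q_def)
  have rad: "p\<^sup>2 + 2 * \<gamma> * q \<ge> 0" using q gamma_pos by simp
  from assms obtain s where s: "s\<^sup>2 = p\<^sup>2 + 2 * \<gamma> * q" and r: "q * r = - p + s"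
  proof
    assume "r = rp"
    then have "r = (- p + sqrt (p\<^sup>2 + 2 * \<gamma> * q)) / q"
      by (simp add: r_plus_def p_def q_def mult.assoc)
    then show ?thesis using that[of "sqrt (p\<^sup>2 + 2 * \<gamma> * q)"] q rad by simp
  next
    assume "r = rm"
    then have "r = (- p - sqrt (p\<^sup>2 + 2 * \<gamma> * q)) / q"
      by (simp add: r_minus_def p_def q_def mult.assoc)
    then show ?thesis using that[of "- sqrt (p\<^sup>2 + 2 * \<gamma> * q)"] q rad by simp
  qed
  have "(q * r + p)\<^sup>2 = p\<^sup>2 + 2 * \<gamma> * q" using r s by simp
  then have "q * (1 / 2 * q * r\<^sup>2 + p * r - \<gamma>) = 0"
    by (simp add: power2_eq_square algebra_simps)
  then have "1 / 2 * q * r\<^sup>2 + p * r - \<gamma> = 0" using q by simp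
  then show ?thesis by (simp add: p_def q_def mult.assoc)
qed

lemma rp_pos: "rp > 0" and rm_neg: "rm < 0"
proof -
  define p where "p = \<alpha> * \<mu> - \<delta>"
  define s where "s = sqrt (p\<^sup>2 + 2 * \<gamma> * \<sigma>\<^sup>2 * \<alpha>\<^sup>2)"
  have q: "\<sigma>\<^sup>2 * \<alpha>\<^sup>2 > 0" using sigma_pos alpha_pos by simp
  have "p\<^sup>2 < p\<^sup>2 + 2 * \<gamma> * \<sigma>\<^sup>2 * \<alpha>\<^sup>2"
    using gamma_pos sigma_pos alpha_pos by simp
  then have "sqrt (p\<^sup>2) < s" unfolding s_def by (rule real_sqrt_less_mono)
  then have "\<bar>p\<bar> < s" by simp
  then show "rp > 0" "rm < 0"
    unfolding r_plus_def r_minus_def p_def[symmetric] s_def[symmetric]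
    using q by (auto intro!: divide_pos_pos divide_neg_pos)
qed

text \<open>The coefficient that \<open>exp (r * x)\<close> contributes to the first-order expression
  \<open>\<sigma>\<^sup>2 \<alpha> V'' + \<mu> V'\<close>.\<close>

definition A :: "real \<Rightarrow> real" where "A r = r * (\<mu> + \<alpha> * \<sigma>\<^sup>2 * r)"

text \<open>Eliminating \<open>r\<^sup>2\<close> by the characteristic equation makes \<open>A r\<close> affine in \<open>r\<close>, with negative
  slope by the hypothesis \<open>2\<delta> / \<mu> < \<alpha>\<close>. This turns \<open>rm < rp\<close> into \<open>A rp < A rm\<close>, which is what
  makes the logarithm in \<open>x_alpha\<close> positive.\<close>

lemma A_root:
  assumes "r = rp \<or> r = rm"
  shows "\<alpha> * A r = 2 * \<gamma> - (\<alpha> * \<mu> - 2 * \<delta>) * r"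
  using characteristic_equation[OF assms]
  by (simp add: A_def power2_eq_square algebra_simps)

lemma A_pos: "A rp > 0" and A_less: "A rp < A rm"
proof -
  show "A rp > 0" unfolding A_def
    using rp_pos mu_pos alpha_pos sigma_pos by (simp add: add_pos_pos)
  have "(\<alpha> * \<mu> - 2 * \<delta>) * rm < 0" "0 < (\<alpha> * \<mu> - 2 * \<delta>) * rp"
    using alpha_mu rp_pos rm_neg by (simp_all add: mult_pos_neg)
  then have "\<alpha> * A rp < \<alpha> * A rm" by (simp add: A_root)
  then show "A rp < A rm" using alpha_pos by simp
qed

lemma x_alpha_eq: "xa = ln (A rm / A rp) / (rp - rm)"
  by (simp add: x_alpha_def A_def Let_def)

lemma x_alpha_pos: "xa > 0"
  unfolding x_alpha_eq using A_pos A_less rp_pos rm_neg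
  by (intro divide_pos_pos ln_gt_zero) (auto simp: field_simps)

text \<open>The defining property of \<open>x_alpha\<close>: the first-order expression of \<open>exp (rp * x) - exp (rm * x)\<close>
  vanishes there.\<close>

lemma A_balance: "A rp * exp (rp * xa) = A rm * exp (rm * xa)"
proof -
  have "(rp - rm) * xa = ln (A rm / A rp)"
    using rp_pos rm_neg by (simp add: x_alpha_eq)
  then have "exp (rp * xa - rm * xa) = exp (ln (A rm / A rp))"
    by (simp only: left_diff_distrib)
  also have "\<dots> = A rm / A rp" using A_pos A_less by (intro exp_ln) simp
  finally show ?thesis using A_pos by (simp add: exp_diff field_simps)
qed

definition V1 where "V1 x = K * (exp (rp * x) - exp (rm * x))"
definition V1' where "V1' x = K * (rp * exp (rp * x) - rm * exp (rm * x))"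
definition V1'' where "V1'' x = K * (rp\<^sup>2 * exp (rp * x) - rm\<^sup>2 * exp (rm * x))"

lemma V1_deriv: "(V1 has_real_derivative V1' x) (at x)"
  and V1'_deriv: "(V1' has_real_derivative V1'' x) (at x)"
  unfolding V1_def[abs_def] V1'_def[abs_def] V1''_def
  by (auto intro!: derivative_eq_intros simp: power2_eq_square algebra_simps)

lemma V1_ode: "1 / 2 * \<sigma>\<^sup>2 * \<alpha>\<^sup>2 * V1'' x + (\<alpha> * \<mu> - \<delta>) * V1' x - \<gamma> * V1 x = 0"
proof -
  have "1 / 2 * \<sigma>\<^sup>2 * \<alpha>\<^sup>2 * V1'' x + (\<alpha> * \<mu> - \<delta>) * V1' x - \<gamma> * V1 x =
     K * (exp (rp * x) * (1 / 2 * \<sigma>\<^sup>2 * \<alpha>\<^sup>2 * rp\<^sup>2 + (\<alpha> * \<mu> - \<delta>) * rp - \<gamma>)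
        - exp (rm * x) * (1 / 2 * \<sigma>\<^sup>2 * \<alpha>\<^sup>2 * rm\<^sup>2 + (\<alpha> * \<mu> - \<delta>) * rm - \<gamma>))"
    unfolding V1_def V1'_def V1''_def by algebra
  also have "\<dots> = 0"
    unfolding characteristic_equation[OF disjI1[OF refl]] characteristic_equation[OF disjI2[OF refl]]
    by simp
  finally show ?thesis .
qed

lemma slope_pos: "rp * exp (rp * x) - rm * exp (rm * x) > 0"
  using mult_pos_pos[OF rp_pos exp_gt_zero] mult_neg_pos[OF rm_neg exp_gt_zero]
  by (smt (verit))

lemma K_pos: "K > 0"
  unfolding K_one_def Let_def
  using slope_pos[of xa] c_less_ct c_less_alpha by (intro divide_pos_pos) auto

lemma V1'_pos: "V1' x > 0"
  unfolding V1'_def using K_pos slope_pos by simp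

lemma V1'_x_alpha: "V1' xa = ((ct - c) / (\<alpha> - c)) powr \<Gamma>"
  unfolding V1'_def K_one_def Let_def using slope_pos[of xa] by simp

lemma V1_first_order_eq:
  "\<sigma>\<^sup>2 * \<alpha> * V1'' x + \<mu> * V1' x = K * (A rp * exp (rp * x) - A rm * exp (rm * x))"
  unfolding V1'_def V1''_def A_def by algebra

lemma V1_first_order_x_alpha: "\<sigma>\<^sup>2 * \<alpha> * V1'' xa + \<mu> * V1' xa = 0"
  by (simp add: V1_first_order_eq A_balance)

text \<open>Since \<open>rm < 0 < rp\<close> and both coefficients \<open>A\<close> are positive, the first-order expression increases
  in \<open>x\<close> up to its zero at \<open>x_alpha\<close>. Left of it the unconstrained maximizer is at most \<open>\<alpha>\<close>.\<close>

lemma V1_first_order: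
  assumes "x \<le> xa"
  shows "\<sigma>\<^sup>2 * \<alpha> * V1'' x + \<mu> * V1' x \<le> 0"
proof -
  have "A rp * exp (rp * x) \<le> A rp * exp (rp * xa)"
    using assms A_pos rp_pos by simp
  also have "\<dots> = A rm * exp (rm * xa)" by (rule A_balance)
  also have "\<dots> \<le> A rm * exp (rm * x)"
    using assms A_pos A_less rm_neg by simp
  finally show ?thesis
    unfolding V1_first_order_eq using K_pos by (simp add: mult_nonneg_nonpos)
qed

lemma V1''_neg:
  assumes "x \<le> xa"
  shows "V1'' x < 0"
proof -
  have "\<sigma>\<^sup>2 * \<alpha> * V1'' x < 0"
    using V1_first_order[OF assms] mult_pos_pos[OF mu_pos V1'_pos[of x]] by linarith
  moreover have "\<sigma>\<^sup>2 * \<alpha> > 0" using sigma_pos alpha_pos by simp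
  ultimately show ?thesis using sigma_pos alpha_pos by (auto simp: mult_less_0_iff)
qed

text \<open>The normalization \<open>K_one\<close> is chosen so that the slope at \<open>x_alpha\<close> is a power of
  \<open>(c_tilde - c) / (\<alpha> - c) > 1\<close>; to the left the slope is larger because \<open>V1\<close> is concave.\<close>

lemma V1'_ge_1:
  assumes "x \<le> xa"
  shows "V1' x \<ge> 1"
proof -
  have "1 \<le> V1' xa"
    unfolding V1'_x_alpha
    using c_less_alpha alpha_less_ct D_pos by (intro ge_one_powr_ge_zero) (auto simp: Gam_def)
  also have "V1' xa \<le> V1' x"
    by (rule DERIV_nonpos_imp_nonincreasing[OF assms])
       (use V1'_deriv V1''_neg in \<open>auto intro: less_imp_le\<close>)
  finally show ?thesis .
qed

section \<open>The zone of varying control\<close>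

lemma G_deriv:
  assumes "u > c"
  shows "(G has_real_derivative u / (u - c)) (at u)"
  unfolding G_fun_def[abs_def] using assms
  by (auto intro!: derivative_eq_intros simp: field_simps)

lemma G_inv_G: "u > c \<Longrightarrow> G_inv \<mu> \<sigma> \<gamma> \<delta> (G u) = u"
  unfolding G_inv_def
  using mu_pos gamma_pos delta_nonneg by (simp add: inv_into_f_f[OF G_fun_inj_on])

lemma G_inv_deriv:
  assumes "u > c"
  shows "(G_inv \<mu> \<sigma> \<gamma> \<delta> has_real_derivative (u - c) / u) (at (G u))"
proof -
  have u: "u > 0" using assms c_nonneg by linarith
  have "continuous_on {c<..} G"
    by (rule DERIV_continuous_on) (use G_deriv in \<open>auto intro: has_field_derivative_at_within\<close>)
  then show ?thesis
    unfolding has_field_derivative_def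
    by (rule has_derivative_inverse_strong[where f' = "(*) (u / (u - c))" and S = "{c<..}", rotated 2])
       (use assms u G_deriv G_inv_G in \<open>auto simp: has_field_derivative_def fun_eq_iff\<close>)
qed

lemma G_alpha_less: "G \<alpha> < G ct"
proof (rule DERIV_pos_imp_increasing[OF alpha_less_ct])
  fix u assume "\<alpha> \<le> u"
  then have "u > c" "u > 0" using c_less_alpha alpha_pos by linarith+
  then show "\<exists>y. (G has_real_derivative y) (at u) \<and> y > 0"
    using G_deriv by (intro exI[of _ "u / (u - c)"]) simp
qed

lemma x_alpha_less_x_one: "xa < x1"
  unfolding x_one_def using G_alpha_less D_pos mu_pos sigma_pos by simp

lemma a_fun_x_alpha: "a xa = \<alpha>"
  using c_less_alpha by (simp add: a_fun_def G_inv_G)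

text \<open>For \<open>c = 0\<close> the function \<open>G_fun\<close> is the identity on the positive half-line and not onto the
  reals, so the intermediate value theorem is used between \<open>\<alpha>\<close> and \<open>c_tilde\<close> to see that the argument of
  \<open>G_inv\<close> lies in the range of \<open>G_fun\<close>. The derivative is that of an inverse function, with
  \<open>G'(u) = u / (u - c)\<close>.\<close>

lemma a_fun_bounds_deriv:
  assumes "xa \<le> x" "x \<le> x1"
  shows "\<alpha> \<le> a x" "a x \<le> ct"
    "(a has_real_derivative D * (a x - c) / (\<mu> * \<sigma>\<^sup>2 * a x)) (at x)"
proof -
  define y where "y t = D / (\<mu> * \<sigma>\<^sup>2) * (t - xa) + G \<alpha>" for t
  have ay: "a = (\<lambda>t. G_inv \<mu> \<sigma> \<gamma> \<delta> (y t))" by (simp add: fun_eq_iff a_fun_def y_def)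
  have k: "D / (\<mu> * \<sigma>\<^sup>2) > 0" using D_pos mu_pos sigma_pos by simp
  have "y xa = G \<alpha>" by (simp add: y_def)
  moreover have "y x1 = G ct"
    using D_pos mu_pos sigma_pos by (simp add: y_def x_one_def)
  moreover have "y s \<le> y t" if "s \<le> t" for s t
    unfolding y_def using that k by (intro add_right_mono mult_left_mono) auto
  then have "y xa \<le> y x" "y x \<le> y x1" using assms by auto
  moreover have "continuous_on {\<alpha>..ct} G"
    by (rule DERIV_continuous_on, rule has_field_derivative_at_within, rule G_deriv)
       (use c_less_alpha in auto)
  ultimately obtain u where u: "\<alpha> \<le> u" "u \<le> ct" "G u = y x"
    using IVT'[of G \<alpha> "y x" ct] alpha_less_ct by auto
  then have uc: "u > c" using c_less_alpha by linarith
  have ax: "a x = u" using G_inv_G[OF uc] u by (simp add: ay)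
  have "(y has_real_derivative D / (\<mu> * \<sigma>\<^sup>2)) (at x)"
    unfolding y_def[abs_def]
    by (rule derivative_eq_intros refl)+ (use mu_pos sigma_pos in simp)
  then have "(a has_real_derivative (u - c) / u * (D / (\<mu> * \<sigma>\<^sup>2))) (at x)"
    unfolding ay by (rule DERIV_chain2[rotated]) (use G_inv_deriv[OF uc] u in simp)
  then show "(a has_real_derivative D * (a x - c) / (\<mu> * \<sigma>\<^sup>2 * a x)) (at x)"
    by (simp add: ax mult_ac)
  show "\<alpha> \<le> a x" "a x \<le> ct" using u ax by auto
qed

text \<open>The slope is defined before the function because the middle piece of \<open>V\<close> is an affine function
  of \<open>a x\<close> times its own derivative.\<close>

definition V2' where "V2' x = ((a x - c) / (ct - c)) powr (- \<Gamma>)"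
definition V2 where "V2 x = (\<mu> * a x - 2 * \<delta>) / (2 * \<gamma>) * V2' x"
definition V2'' where "V2'' x = - (\<mu> / (\<sigma>\<^sup>2 * a x)) * V2' x"

text \<open>In \<open>V2'' / V2' = - \<Gamma> a' / (a - c)\<close> the factor \<open>a - c\<close> cancels against \<open>a'\<close>, and
  \<open>D \<Gamma> = \<mu>\<^sup>2\<close> leaves \<open>- \<mu> / (\<sigma>\<^sup>2 a)\<close>.\<close>

lemma V2'_deriv:
  assumes "xa \<le> x" "x \<le> x1"
  shows "(V2' has_real_derivative V2'' x) (at x)"
proof -
  have ac: "a x > c" and a0: "a x > 0"
    using a_fun_bounds_deriv(1)[OF assms] c_less_alpha alpha_pos by linarith+
  define q where "q = (a x - c) / (ct - c)"
  have q: "q > 0" using ac c_less_ct by (simp add: q_def)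
  have "(V2' has_real_derivative
      - \<Gamma> * q powr (- \<Gamma> - 1) * (D * (a x - c) / (\<mu> * \<sigma>\<^sup>2 * a x) / (ct - c))) (at x)"
    unfolding V2'_def[abs_def] q_def
    by (rule DERIV_chain2[OF has_real_derivative_powr DERIV_cdivide])
       (use q DERIV_diff[OF a_fun_bounds_deriv(3)[OF assms] DERIV_const] in \<open>simp_all add: q_def\<close>)
  moreover have "- \<Gamma> * q powr (- \<Gamma> - 1) * (D * (a x - c) / (\<mu> * \<sigma>\<^sup>2 * a x) / (ct - c))
      = - (D * \<Gamma> / (\<mu> * \<sigma>\<^sup>2 * a x)) * (q powr (- \<Gamma> - 1) * q)"
    by (simp add: q_def)
  moreover have "q powr (- \<Gamma> - 1) * q = q powr (- \<Gamma>)"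
    using q by (simp add: powr_diff)
  moreover have "q powr (- \<Gamma>) = V2' x" by (simp add: V2'_def q_def)
  moreover have "D * \<Gamma> / (\<mu> * \<sigma>\<^sup>2 * a x) = \<mu> / (\<sigma>\<^sup>2 * a x)"
    unfolding D_Gam using mu_pos by (simp add: power2_eq_square)
  ultimately show ?thesis by (simp only: V2''_def)
qed

lemma V2_deriv:
  assumes "xa \<le> x" "x \<le> x1"
  shows "(V2 has_real_derivative V2' x) (at x)"
proof -
  have a0: "a x > 0"
    using a_fun_bounds_deriv(1)[OF assms] alpha_pos by linarith
  define d where "d = D * (a x - c) / (\<mu> * \<sigma>\<^sup>2 * a x)"
  have "(V2 has_real_derivative
      \<mu> * d / (2 * \<gamma>) * V2' x + (\<mu> * a x - 2 * \<delta>) / (2 * \<gamma>) * V2'' x) (at x)"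
    unfolding V2_def[abs_def] d_def
    by (rule DERIV_mult[OF DERIV_cdivide V2'_deriv[OF assms], THEN DERIV_cong])
       (auto intro!: DERIV_diff[THEN DERIV_cong] DERIV_cmult DERIV_const
          a_fun_bounds_deriv(3)[OF assms] simp: mult.commute)
  \<comment> \<open>Clearing denominators, this is the identity \<open>D - \<mu>\<^sup>2 = 2 \<gamma> \<sigma>\<^sup>2\<close> together with \<open>D c = 2 \<delta> \<mu>\<close>.\<close>
  moreover have "\<mu> * d / (2 * \<gamma>) - (\<mu> * a x - 2 * \<delta>) / (2 * \<gamma>) * (\<mu> / (\<sigma>\<^sup>2 * a x)) = 1"
  proof -
    have "\<mu> * d = D * (a x - c) / (\<sigma>\<^sup>2 * a x)"
      using mu_pos by (simp add: d_def)
    also have "D * (a x - c) = D * a x - D * c" by (rule right_diff_distrib)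
    finally have "\<mu> * d - (\<mu> * a x - 2 * \<delta>) * (\<mu> / (\<sigma>\<^sup>2 * a x)) = 2 * \<gamma>"
      unfolding D_c using a0 sigma_pos by (simp add: field_simps power2_eq_square)
    then have "(\<mu> * d - (\<mu> * a x - 2 * \<delta>) * (\<mu> / (\<sigma>\<^sup>2 * a x))) / (2 * \<gamma>) = 1"
      using gamma_pos by simp
    then show ?thesis by (simp only: diff_divide_distrib[of "\<mu> * d"] times_divide_eq_left)
  qed
  then have "\<mu> * d / (2 * \<gamma>) * V2' x + (\<mu> * a x - 2 * \<delta>) / (2 * \<gamma>) * V2'' x = V2' x"
    unfolding V2''_def by algebra
  ultimately show ?thesis by simp
qed

lemma V2_first_order:
  assumes "xa \<le> x" "x \<le> x1"
  shows "\<sigma>\<^sup>2 * a x * V2'' x + \<mu> * V2' x = 0"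
  using a_fun_bounds_deriv(1)[OF assms] alpha_pos sigma_pos by (simp add: V2''_def)

lemma V2_ode:
  assumes "xa \<le> x" "x \<le> x1"
  shows "1 / 2 * \<sigma>\<^sup>2 * (a x)\<^sup>2 * V2'' x + (a x * \<mu> - \<delta>) * V2' x - \<gamma> * V2 x = 0"
proof -
  have "\<gamma> * V2 x = (\<mu> * a x / 2 - \<delta>) * V2' x"
    using gamma_pos by (simp add: V2_def field_simps)
  then show ?thesis using V2_first_order[OF assms] by algebra
qed

lemma V2'_ge_1:
  assumes "xa \<le> x" "x \<le> x1"
  shows "V2' x \<ge> 1"
proof -
  define q where "q = (a x - c) / (ct - c)"
  have q: "q > 0" "q \<le> 1"
    using a_fun_bounds_deriv[OF assms] c_less_alpha c_less_ct by (auto simp: q_def)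
  have "\<Gamma> \<ge> 0" using D_pos by (simp add: Gam_def)
  then have "q powr \<Gamma> \<le> 1" "q powr \<Gamma> > 0" using q by (simp_all add: powr_le1)
  then show ?thesis
    unfolding V2'_def q_def[symmetric] powr_minus by (intro one_le_inverse)
qed

lemma V2''_neg:
  assumes "xa \<le> x" "x \<le> x1"
  shows "V2'' x < 0"
proof -
  have "a x > 0" using a_fun_bounds_deriv(1)[OF assms] alpha_pos by linarith
  then show ?thesis
    using V2'_ge_1[OF assms] mu_pos sigma_pos by (simp add: V2''_def mult_neg_pos)
qed

text \<open>The slopes agree by the choice of \<open>K_one\<close>. Both pieces satisfy the first-order condition with control
  \<open>\<alpha>\<close>, which gives equal second derivatives, and then the linear equation gives equal values.\<close>

lemma match_x_alpha: "V1 xa = V2 xa" "V1' xa = V2' xa" "V1'' xa = V2'' xa"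
proof -
  have x: "xa \<le> xa" "xa \<le> x1" using x_alpha_less_x_one by auto
  have "V2' xa = ((\<alpha> - c) / (ct - c)) powr (- \<Gamma>)" by (simp add: V2'_def a_fun_x_alpha)
  also have "\<dots> = ((ct - c) / (\<alpha> - c)) powr \<Gamma>"
    using c_less_alpha c_less_ct by (simp add: powr_minus powr_divide)
  finally show 1: "V1' xa = V2' xa" by (simp add: V1'_x_alpha)
  have "\<sigma>\<^sup>2 * \<alpha> * V1'' xa = \<sigma>\<^sup>2 * \<alpha> * V2'' xa"
    using V1_first_order_x_alpha V2_first_order[OF x] unfolding a_fun_x_alpha 1 by linarith
  then show 2: "V1'' xa = V2'' xa" using sigma_pos alpha_pos by simp
  have "\<gamma> * V1 xa = \<gamma> * V2 xa"
    using V1_ode[of xa] V2_ode[OF x] 1 2 by (simp add: a_fun_x_alpha)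
  then show "V1 xa = V2 xa" using gamma_pos by simp
qed

section \<open>The zone of constant control \<open>c_tilde\<close>\<close>

definition V3' where "V3' x = exp (- (\<mu> / (\<sigma>\<^sup>2 * ct)) * (x - x1))"
definition V3 where "V3 x = M / \<gamma> - \<sigma>\<^sup>2 * ct / \<mu> * V3' x"
definition V3'' where "V3'' x = - (\<mu> / (\<sigma>\<^sup>2 * ct)) * V3' x"

lemma V3'_deriv: "(V3' has_real_derivative V3'' x) (at x)"
  unfolding V3'_def[abs_def] V3''_def
  by (rule derivative_eq_intros refl)+ (use sigma_pos ct_pos in simp)

lemma V3_deriv: "(V3 has_real_derivative V3' x) (at x)"
  unfolding V3_def[abs_def]
  by (rule derivative_eq_intros V3'_deriv refl)+
     (use mu_pos sigma_pos ct_pos in \<open>simp add: V3''_def\<close>)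

lemma V3_first_order: "\<sigma>\<^sup>2 * ct * V3'' x + \<mu> * V3' x = 0"
  using sigma_pos ct_pos by (simp add: V3''_def)

text \<open>The constants cancel because \<open>\<gamma> V3\<close> has constant part \<open>M\<close>; the coefficient of \<open>V3'\<close> vanishes exactly
  when the control is \<open>c_tilde\<close>.\<close>

lemma V3_ode:
  "1 / 2 * \<sigma>\<^sup>2 * ct\<^sup>2 * V3'' x + (ct * \<mu> - \<delta>) * V3' x - \<gamma> * V3 x + M * (1 - V3' x) = 0"
proof -
  have g: "\<gamma> * V3 x = M - \<gamma> * \<sigma>\<^sup>2 * ct / \<mu> * V3' x"
    using gamma_pos by (simp add: V3_def right_diff_distrib)
  have "\<mu> * (ct * \<mu> / 2 - \<delta> - M) + \<gamma> * \<sigma>\<^sup>2 * ct = 0"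
    using D_ct by (simp add: algebra_simps power2_eq_square)
  then have "ct * \<mu> / 2 - \<delta> - M + \<gamma> * \<sigma>\<^sup>2 * ct / \<mu> = 0"
    using mu_pos by (simp add: field_simps)
  then show ?thesis using V3_first_order[of x] g by algebra
qed

text \<open>As at \<open>x_alpha\<close>, with common control \<open>c_tilde\<close>; the slope is \<open>1\<close> on both sides, so the
  term \<open>M (1 - V')\<close> vanishes and the two linear equations coincide.\<close>

lemma match_x_one: "V2 x1 = V3 x1" "V2' x1 = V3' x1" "V2'' x1 = V3'' x1"
proof -
  have x: "xa \<le> x1" "x1 \<le> x1" using x_alpha_less_x_one by auto
  have ax: "a x1 = ct"
    using mu_pos sigma_pos gamma_pos delta_nonneg M_pos by (rule a_fun_x_one)
  have 1: "V2' x1 = 1" "V3' x1 = 1" using c_less_ct by (simp_all add: V2'_def V3'_def ax)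
  then show "V2' x1 = V3' x1" by simp
  show 2: "V2'' x1 = V3'' x1" by (simp add: V2''_def V3''_def ax 1)
  have "\<gamma> * V2 x1 = \<gamma> * V3 x1"
    using V2_ode[OF x] V3_ode[of x1] 1 2 by (simp add: ax)
  then show "V2 x1 = V3 x1" using gamma_pos by simp
qed

section \<open>The glued function\<close>

abbreviation V where "V \<equiv> V_fun \<mu> \<sigma> \<gamma> \<delta> M \<alpha>"

definition V' where "V' x = (if x < xa then V1' x else if x < x1 then V2' x else V3' x)"
definition V'' where "V'' x = (if x < xa then V1'' x else if x < x1 then V2'' x else V3'' x)"

lemma V_eq: "V x = (if x < xa then V1 x else if x < x1 then V2 x else V3 x)"
  by (simp add: V_fun_def V1_def V2_def V2'_def V3_def V3'_def Let_def)

lemma V_deriv: "(V has_real_derivative V' x) (at x)"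
proof -
  have "((\<lambda>t. if t < x1 then V2 t else V3 t) has_real_derivative
          (if x < x1 then V2' x else V3' x)) (at x)" if "xa \<le> x"
    by (rule DERIV_glue) (use that V2_deriv V3_deriv match_x_one in auto)
  then have "((\<lambda>t. if t < xa then V1 t else if t < x1 then V2 t else V3 t) has_real_derivative
          (if x < xa then V1' x else if x < x1 then V2' x else V3' x)) (at x)"
    by (intro DERIV_glue[where h' = "\<lambda>x. if x < x1 then V2' x else V3' x"])
       (use V1_deriv match_x_alpha x_alpha_less_x_one in auto)
  then show ?thesis by (simp add: V_eq[abs_def] V'_def)
qed

lemma V'_deriv: "(V' has_real_derivative V'' x) (at x)"
proof -
  have "((\<lambda>t. if t < x1 then V2' t else V3' t) has_real_derivative
          (if x < x1 then V2'' x else V3'' x)) (at x)" if "xa \<le> x"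
    by (rule DERIV_glue) (use that V2'_deriv V3'_deriv match_x_one in auto)
  then have "((\<lambda>t. if t < xa then V1' t else if t < x1 then V2' t else V3' t) has_real_derivative
          (if x < xa then V1'' x else if x < x1 then V2'' x else V3'' x)) (at x)"
    by (intro DERIV_glue[where h' = "\<lambda>x. if x < x1 then V2'' x else V3'' x"])
       (use V1'_deriv match_x_alpha x_alpha_less_x_one in auto)
  then show ?thesis by (simp add: V'_def[abs_def] V''_def)
qed

lemma V'_pos: "V' x > 0"
proof -
  have "V2' x > 0" if "xa \<le> x" "x \<le> x1" using V2'_ge_1[OF that] by linarith
  then show ?thesis by (simp add: V'_def V1'_pos V3'_def)
qed

lemma V''_neg: "V'' x < 0"
proof -
  have "V3'' x < 0" using mu_pos sigma_pos ct_pos by (simp add: V3''_def V3'_def)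
  then show ?thesis using V1''_neg V2''_neg by (simp add: V''_def)
qed

lemma V_concave: "concave_on {0..} V"
  by (rule f''_le0_imp_concave[where f' = V' and f'' = V''])
     (auto simp: V_deriv V'_deriv V''_neg less_imp_le)

lemma V_0: "V 0 = 0"
  using x_alpha_pos by (simp add: V_eq V1_def)

lemma V_mono: "x \<le> y \<Longrightarrow> V x \<le> V y"
  by (erule DERIV_nonneg_imp_nondecreasing) (meson V_deriv V'_pos less_imp_le)

lemma V_bounds:
  assumes "x > 0"
  shows "0 \<le> V x" "V x \<le> M / \<gamma>"
proof -
  show "0 \<le> V x" using V_mono[of 0 x] assms by (simp add: V_0)
  \<comment> \<open>Moving right into the last zone only increases the value, and there the bound is visible.\<close>
  have "V x \<le> V (max x x1)" by (rule V_mono) simp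
  also have "\<dots> = V3 (max x x1)" using x_alpha_less_x_one by (simp add: V_eq)
  also have "\<dots> \<le> M / \<gamma>"
    using mu_pos ct_pos by (simp add: V3_def V3'_def)
  finally show "V x \<le> M / \<gamma>" .
qed

lemma V_hjb: "is_max_on (hjb_expr \<mu> \<sigma> \<gamma> \<delta> M (V x) (V' x) (V'' x)) {\<alpha>..\<beta>} 0"
proof -
  consider "x < xa" | "xa \<le> x" "x < x1" | "x1 \<le> x" by linarith
  then show ?thesis
  proof cases
    case 1
    then have eqs: "V x = V1 x" "V' x = V1' x" "V'' x = V1'' x"
      by (simp_all add: V_eq V'_def V''_def)
    show ?thesis
    proof (rule is_max_on_hjb_expr[where a\<^sub>0 = \<alpha>])
      show "hjb_expr \<mu> \<sigma> \<gamma> \<delta> M (V x) (V' x) (V'' x) \<alpha> = 0"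
        using V1_ode[of x] V1'_ge_1[of x] 1 by (simp add: hjb_expr_def eqs)
      show "(b - \<alpha>) * (\<sigma>\<^sup>2 * \<alpha> * V'' x + \<mu> * V' x) \<le> 0" if "b \<in> {\<alpha>..\<beta>}" for b
        using V1_first_order[of x] 1 that by (simp add: eqs mult_nonneg_nonpos)
      show "\<alpha> \<in> {\<alpha>..\<beta>}" using alpha_less_beta by simp
    qed (rule less_imp_le[OF V''_neg])
  next
    case 2
    then have eqs: "V x = V2 x" "V' x = V2' x" "V'' x = V2'' x"
      by (simp_all add: V_eq V'_def V''_def)
    from 2 have x: "xa \<le> x" "x \<le> x1" by simp_all
    show ?thesis
    proof (rule is_max_on_hjb_expr[where a\<^sub>0 = "a x"])
      show "hjb_expr \<mu> \<sigma> \<gamma> \<delta> M (V x) (V' x) (V'' x) (a x) = 0"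
        using V2_ode[OF x] V2'_ge_1[OF x] by (simp add: hjb_expr_def eqs)
      show "a x \<in> {\<alpha>..\<beta>}" using a_fun_bounds_deriv[OF x] ct_le_beta by auto
      show "(b - a x) * (\<sigma>\<^sup>2 * a x * V'' x + \<mu> * V' x) \<le> 0" for b
        unfolding eqs V2_first_order[OF x] by simp
    qed (rule less_imp_le[OF V''_neg])
  next
    case 3
    then have eqs: "V x = V3 x" "V' x = V3' x" "V'' x = V3'' x"
      using x_alpha_less_x_one by (simp_all add: V_eq V'_def V''_def)
    have "V3' x \<le> 1"
      using 3 mu_pos ct_pos sigma_pos by (simp add: V3'_def)
    show ?thesis
    proof (rule is_max_on_hjb_expr[where a\<^sub>0 = ct])
      show "hjb_expr \<mu> \<sigma> \<gamma> \<delta> M (V x) (V' x) (V'' x) ct = 0"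
        using V3_ode[of x] \<open>V3' x \<le> 1\<close> by (simp add: hjb_expr_def eqs)
      show "ct \<in> {\<alpha>..\<beta>}" using alpha_less_ct ct_le_beta by simp
      show "(b - ct) * (\<sigma>\<^sup>2 * ct * V'' x + \<mu> * V' x) \<le> 0" for b
        unfolding eqs V3_first_order by simp
    qed (rule less_imp_le[OF V''_neg])
  qed
qed

lemma V_hjb_solution: "hjb_solution \<mu> \<sigma> \<gamma> \<delta> M \<alpha> \<beta> V"
proof -
  have "\<forall>x\<in>{0..}. (V has_real_derivative V' x) (at x within {0..})"
    using V_deriv by (simp add: has_field_derivative_at_within)
  moreover have "\<forall>x\<in>{0..}. (V' has_real_derivative V'' x) (at x within {0..})"
    using V'_deriv by (simp add: has_field_derivative_at_within)
  moreover have "\<forall>x\<in>{0..}. is_max_on (hjb_expr \<mu> \<sigma> \<gamma> \<delta> M (V x) (V' x) (V'' x)) {\<alpha>..\<beta>} 0"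
    by (intro ballI V_hjb)
  ultimately show ?thesis
    unfolding hjb_solution_def using V_0
    by (intro conjI exI[where x = V'] exI[where x = V''])
qed

end

theorem theorem3p9:
  fixes \<mu> \<sigma> \<gamma> \<delta> M \<alpha> \<beta> :: real
  assumes "\<mu> > 0" and "\<sigma> > 0" and "\<gamma> > 0" and "\<delta> \<ge> 0" and "M > 0"
    and "0 < \<alpha>" and "\<alpha> < \<beta>"
    and "2 * \<delta> / \<mu> < \<alpha>"
    and "M_level \<mu> \<sigma> \<gamma> \<delta> \<alpha> < M" and "M \<le> M_level \<mu> \<sigma> \<gamma> \<delta> \<beta>"
  shows "concave_on {0..} (V_fun \<mu> \<sigma> \<gamma> \<delta> M \<alpha>) \<and>
    hjb_solution \<mu> \<sigma> \<gamma> \<delta> M \<alpha> \<beta> (V_fun \<mu> \<sigma> \<gamma> \<delta> M \<alpha>) \<and>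
    (\<forall>x>0. 0 \<le> V_fun \<mu> \<sigma> \<gamma> \<delta> M \<alpha> x \<and> V_fun \<mu> \<sigma> \<gamma> \<delta> M \<alpha> x \<le> M / \<gamma>)"
proof -
  interpret hjb_parameters \<mu> \<sigma> \<gamma> \<delta> M \<alpha> \<beta>
    using assms by (rule hjb_parameters.intro)
  show ?thesis using V_concave V_hjb_solution V_bounds by simp
qed

end
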